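(* Let $k\geq 3$, let $n=p^\alpha$ be a power of a prime $p$, let $q=p^\omega$ with $\omega\mid\alpha$, and let $H=\mathrm{Gal}(GF(n)/GF(q))$. Then the AST obtained from the action of $ASL_H(k,n)$ on $V=GF(n)^k$ is equal to the AST obtained from the action of $AGL_H(k,n)$ on $V$; that is, the two groups have the same orbits on $V\times V\times V$.
   Context: If a group $G$ acts two-transitively on a finite set $\Omega$ with at least 3 elements, the set of orbits of the induced diagonal action of $G$ on $\Omega\times\Omega\times\Omega$ is an association scheme on triples (AST), called the AST obtained from (the action of) $G$; it is this partition of $\Omega\times\Omega\times\Omega$ into orbits. $GF(n)$ is the field with $n$ elements, $V=GF(n)^k$, and $H$ acts on $V$ coordinatewise. $ASL_H(k,n)=ASL(k,n)\rtimes H$ is the group of maps $V\to V$ of the form $x\mapsto A\phi(x)+b$ with $A\in SL(k,n)$, $b\in V$, $\phi\in H$. $AGL_H(k,n)=AGL(k,n)\rtimes H$ is the group of maps $V\to V$ of the form $x\mapsto A\phi(x)+b$ with $A\in GL(k,n)$, $b\in V$, $\phi\in H$. Both act two-transitively on $V$. *)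

theory Defs
  imports
    "HOL-Analysis.Determinants"
    "HOL-Algebra.Group_Action"
    "HOL-Algebra.Algebraic_Closure_Type"
begin

text \<open>
  The AST obtained from an action \<open>act\<close> of \<open>G\<close> on \<open>\<Omega>\<close>: the set of orbits of the diagonal
  action of \<open>G\<close> on \<open>\<Omega> \<times> \<Omega> \<times> \<Omega>\<close>.  It is an association scheme on triples when the
  action is two-transitive and \<open>\<Omega>\<close> is finite with at least three elements.
\<close>

definition AST_of ::
  "('g, 'm) monoid_scheme \<Rightarrow> 'v set \<Rightarrow> ('g \<Rightarrow> 'v \<Rightarrow> 'v) \<Rightarrow> ('v \<times> 'v \<times> 'v) set set"
  where "AST_of G \<Omega> act =
    orbits G (\<Omega> \<times> \<Omega> \<times> \<Omega>) (\<lambda>g (x, y, z). (act g x, act g y, act g z))"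

text \<open>
  \<open>Gal F\<close> is the Galois group over the subfield \<open>F\<close> of the field given by the whole type \<open>'a\<close>.
\<close>

definition Gal :: "'a::field set \<Rightarrow> ('a \<Rightarrow> 'a) set"
  where "Gal F =
    {\<phi> \<in> ring_iso ring_of_type_algebra ring_of_type_algebra. \<forall>x\<in>F. \<phi> x = x}"

definition semiaffine ::
  "'a::field^'k^'k \<Rightarrow> ('a \<Rightarrow> 'a) \<Rightarrow> 'a^'k \<Rightarrow> 'a^'k \<Rightarrow> 'a^'k"
  where "semiaffine A \<phi> b = (\<lambda>x. A *v (\<chi> i. \<phi> (x $ i)) + b)"

text \<open>
  The semidirect products are realised as permutation groups of the vector space,
  for \<open>H\<close> a group of field automorphisms.
\<close>

definition ASL :: "('a::field \<Rightarrow> 'a) set \<Rightarrow> ('a^'k::finite \<Rightarrow> 'a^'k) monoid"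
  where "ASL H = (BijGroup UNIV)
    \<lparr>carrier := {semiaffine A \<phi> b | A \<phi> b. det A = 1 \<and> \<phi> \<in> H}\<rparr>"

definition AGL :: "('a::field \<Rightarrow> 'a) set \<Rightarrow> ('a^'k::finite \<Rightarrow> 'a^'k) monoid"
  where "AGL H = (BijGroup UNIV)
    \<lparr>carrier := {semiaffine A \<phi> b | A \<phi> b. invertible A \<and> \<phi> \<in> H}\<rparr>"

end

theory Submission
  imports Defs
begin

text \<open>
  Two vectors of a space of dimension at least three are annihilated by a nonzero linear
  functional, so a map \<open>x \<mapsto> x + f(x) e\<^sub>j\<close> fixes both of them and can have any prescribed
  determinant.  Composing a semiaffine map with such a map on the inside corrects its determinant
  to 1 without changing the images of three given points.
\<close>

text \<open>A square matrix with \<open>u\<close> and \<open>v\<close> as two of its rows and zeros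
  elsewhere has a zero row as soon as there is a third index. It is therefore singular, and a
  nonzero vector of its kernel serves as \<open>w\<close>.\<close>

lemma exists_nonzero_annihilator:
  fixes u v :: "'a::field^'k"
  assumes "CARD('k) \<ge> 3"
  obtains w where "w \<noteq> 0" "(\<Sum>i\<in>UNIV. w $ i * u $ i) = 0" "(\<Sum>i\<in>UNIV. w $ i * v $ i) = 0"
proof -
  obtain T :: "'k set" where "card T = 3"
    using obtain_subset_with_card_n[OF assms] by blast
  then obtain a b c :: 'k where abc: "a \<noteq> b" "a \<noteq> c" "b \<noteq> c"
    by (auto simp: card_3_iff)
  define B :: "'a^'k^'k" where "B = (\<chi> i. if i = a then u else if i = b then v else 0)"
  have "row c B = 0"
    using abc by (simp add: row_def B_def vec_eq_iff)
  then have "det B = 0"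
    by (rule det_zero_row)
  then have "\<not> invertible B"
    by (simp add: invertible_det_nz)
  then obtain w where "w \<noteq> 0" and w: "B *v w = 0"
    by (auto simp: invertible_left_inverse matrix_left_invertible_ker)
  have "(B *v w) $ a = 0" "(B *v w) $ b = 0"
    using w by simp_all
  then show thesis
    using that[OF \<open>w \<noteq> 0\<close>] abc by (simp add: matrix_vector_mult_def B_def mult.commute)
qed

lemma exists_matrix_fixing_two_vectors_det:
  fixes u v :: "'a::field^'k"
  assumes "CARD('k) \<ge> 3"
  obtains C where "C *v u = u" "C *v v = v" "det C = d"
proof -
  obtain w where "w \<noteq> 0" and w: "(\<Sum>i\<in>UNIV. w $ i * u $ i) = 0" "(\<Sum>i\<in>UNIV. w $ i * v $ i) = 0"
    using exists_nonzero_annihilator[OF assms] .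
  then obtain j where j: "w $ j \<noteq> 0"
    by (auto simp: vec_eq_iff)
  \<comment> \<open>This solves \<open>1 + t * w $ j = d\<close>, whose left side is the determinant
    of the identity plus \<open>t *s w\<close> added to row \<open>j\<close>.\<close>
  define t where "t = (d - 1) / w $ j"
  define C :: "'a^'k^'k" where "C = (\<chi> i. axis i 1 + (if i = j then t *s w else 0))"
  have C_mult: "C *v x = x + (t * (\<Sum>i\<in>UNIV. w $ i * x $ i)) *s axis j 1" for x
  proof -
    have "(\<Sum>k\<in>UNIV. axis i 1 $ k * x $ k) = x $ i" for i
      by (simp add: axis_def if_distrib[of "\<lambda>c. c * _"] cong: if_cong)
    then show ?thesis
      by (simp add: vec_eq_iff matrix_vector_mult_def C_def axis_def
          distrib_right sum.distrib sum_distrib_left mult.assoc)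
  qed
  \<comment> \<open>\<open>D\<close> is diagonal with the single entry \<open>d\<close> at
    \<open>j\<close> and ones elsewhere. Row \<open>j\<close> of \<open>C\<close> exceeds that of
    \<open>D\<close> by \<open>r\<close>, a combination of the other rows, so both determinants
    agree.\<close>
  define D :: "'a^'k^'k" where "D = (\<chi> i. if i = j then d *s axis j 1 else axis i 1)"
  define r where "r = t *s (\<Sum>i\<in>UNIV - {j}. w $ i *s axis i 1)"
  have w_sum: "w = w $ j *s axis j 1 + (\<Sum>i\<in>UNIV - {j}. w $ i *s axis i 1)"
  proof -
    have "w = (\<Sum>i\<in>UNIV. w $ i *s axis i 1)"
      by (simp add: basis_expansion)
    then show ?thesis
      by (simp add: sum.remove[of UNIV j])
  qed
  have "axis j 1 + t *s w = d *s axis j 1 + r"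
  proof -
    have "t *s w = (t * w $ j) *s axis j 1 + r"
      by (subst w_sum) (simp add: r_def vec.scale_right_distrib)
    also have "t * w $ j = d - 1"
      using j by (simp add: t_def)
    finally show ?thesis
      by (simp add: vec.scale_left_diff_distrib)
  qed
  then have C_eq: "C = (\<chi> k. if k = j then row j D + r else row k D)"
    by (simp add: vec_eq_iff C_def D_def row_def)
  have "r \<in> vec.span {row i D |i. i \<noteq> j}"
  proof -
    have "axis i 1 \<in> vec.span {row i D |i. i \<noteq> j}" if "i \<noteq> j" for i
      using that by (intro vec.span_base) (auto simp: D_def row_def vec_eq_iff)
    then show ?thesis
      unfolding r_def by (intro vec.span_scale vec.span_sum) auto
  qed
  then have "det C = det D"
    unfolding C_eq by (rule det_row_span)
  also have "det D = d"
  proof -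
    have "det D = (\<Prod>i\<in>UNIV. D $ i $ i)"
      by (rule det_diagonal) (auto simp: D_def axis_def)
    also have "\<dots> = (\<Prod>i\<in>UNIV. if i = j then d else 1)"
      by (intro prod.cong) (auto simp: D_def axis_def)
    finally show ?thesis
      by simp
  qed
  finally show thesis
    using w by (intro that[of C]) (simp_all add: C_mult)
qed

text \<open>Three points impose only two linear conditions: the translation can be adjusted to match
  the image of \<open>x\<close>, and then the images of \<open>y\<close> and \<open>z\<close> match
  once the linear parts agree on the differences from \<open>x\<close>, taken after applying
  \<open>\<phi>\<close> coordinatewise.\<close>

lemma semiaffine_det_1_agreeing_on_triple:
  fixes A :: "'a::field^'k^'k"
  assumes "CARD('k) \<ge> 3" "invertible A"
  obtains A' b' where "det A' = 1" "semiaffine A' \<phi> b' x = semiaffine A \<phi> b x"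
    "semiaffine A' \<phi> b' y = semiaffine A \<phi> b y" "semiaffine A' \<phi> b' z = semiaffine A \<phi> b z"
proof -
  define f :: "'a^'k \<Rightarrow> 'a^'k" where "f = (\<lambda>x. \<chi> i. \<phi> (x $ i))"
  have semiaffine: "semiaffine M \<phi> c = (\<lambda>x. M *v f x + c)" for M c
    by (simp add: semiaffine_def f_def)
  obtain C where C: "C *v (f y - f x) = f y - f x" "C *v (f z - f x) = f z - f x"
    and det: "det C = inverse (det A)"
    using exists_matrix_fixing_two_vectors_det[OF assms(1)] .
  have "det (A ** C) = 1"
    using assms(2) by (simp add: det_mul det invertible_det_nz)
  \<comment> \<open>The new translation is the one forced by agreement at \<open>x\<close>. The case
    \<open>s = x\<close> is covered too, since \<open>C\<close> fixes the zero vector.\<close>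
  moreover have "(A ** C) *v f s + (A *v f x + b - (A ** C) *v f x) = A *v f s + b"
    if "C *v (f s - f x) = f s - f x" for s
  proof -
    have "(A ** C) *v (f s - f x) = A *v (f s - f x)"
      using that by (simp flip: matrix_vector_mul_assoc)
    then show ?thesis
      by (simp add: matrix_vector_mult_diff_distrib algebra_simps)
  qed
  ultimately show thesis
    using C by (intro that[of "A ** C" "A *v f x + b - (A ** C) *v f x"]) (simp_all add: semiaffine)
qed

text \<open>The matrix correcting the determinant depends on the triple, so the groups are compared
  one orbit at a time. The automorphism \<open>\<phi>\<close> is kept, hence the argument is uniform
  in \<open>H\<close>.\<close>

lemma orbit_ASL_eq_orbit_AGL:
  fixes H :: "('a::field \<Rightarrow> 'a) set" and t :: "('a^'k) \<times> ('a^'k) \<times> ('a^'k)"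
  defines "act \<equiv> \<lambda>g :: 'a^'k \<Rightarrow> 'a^'k. \<lambda>(x, y, z). (g x, g y, g z)"
  assumes "CARD('k) \<ge> 3"
  shows "orbit (ASL H) act t = orbit (AGL H) act t"
proof
  show "orbit (ASL H) act t \<subseteq> orbit (AGL H) act t"
    by (fastforce simp: orbit_def ASL_def AGL_def invertible_det_nz)
  show "orbit (AGL H) act t \<subseteq> orbit (ASL H) act t"
  proof
    fix s assume "s \<in> orbit (AGL H) act t"
    then obtain A \<phi> b where A: "invertible A" and \<phi>: "\<phi> \<in> H" and s: "s = act (semiaffine A \<phi> b) t"
      by (auto simp: orbit_def AGL_def)
    obtain x y z where t: "t = (x, y, z)"
      by (cases t)
    obtain A' b' where "det A' = 1"
      and "semiaffine A' \<phi> b' x = semiaffine A \<phi> b x"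
        "semiaffine A' \<phi> b' y = semiaffine A \<phi> b y"
        "semiaffine A' \<phi> b' z = semiaffine A \<phi> b z"
      using semiaffine_det_1_agreeing_on_triple[OF assms(2) A] .
    then have "s = act (semiaffine A' \<phi> b') t"
      by (simp add: s t act_def)
    with \<phi> \<open>det A' = 1\<close> show "s \<in> orbit (ASL H) act t"
      by (auto simp: orbit_def ASL_def)
  qed
qed

theorem theorem3p5:
  fixes p \<alpha> \<omega> n q :: nat
    and F :: "'a::{field, finite} set"
  assumes "CARD('k::finite) \<ge> 3"
    and "Factorial_Ring.prime p"
    and "n = p ^ \<alpha>"
    and "q = p ^ \<omega>"
    and "\<omega> dvd \<alpha>"
    and "CARD('a) = n"
    and "subfield F (ring_of_type_algebra :: 'a ring)"
    and "card F = q"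
  shows "AST_of (ASL (Gal F)) (UNIV :: ('a^'k) set) (\<lambda>g. g)
       = AST_of (AGL (Gal F)) (UNIV :: ('a^'k) set) (\<lambda>g. g)"
  unfolding AST_of_def orbits_def orbit_ASL_eq_orbit_AGL[OF assms(1)] ..

end
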